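(* Let $\alpha_1>0$ and $|\beta_1|<\alpha_1$, let $F_T$, $Q_T$ be the distribution and quantile functions of the hyperbolic distribution $\mathrm{Hyp}(\alpha_1,\beta_1,1,0)$, and let $Q_B$, $p_m$, $p_-$, $p_+$ be as in the context. Let $N_0=2\alpha_1K_1(\gamma_1)/\gamma_1$ with $\gamma_1=\sqrt{\alpha_1^2-\beta_1^2}$. Left problem: let $u_0\in(0,p_m]$, and put $\theta=p_-$, $\phi=+1$, $\rho=\alpha_1+\beta_1$, $\kappa=\alpha_1+\beta_1$. Right problem: let $u_0\in[p_m,1)$, and put $\theta=p_+$, $\phi=-1$, $\rho=-(\alpha_1-\beta_1)$, $\kappa=\alpha_1-\beta_1$. In either case let $z_0=Q_B(u_0)$, $x_0=Q_T(u_0)$, and let $A$ be the solution near $z_0$ of the initial value problem $$\frac{dA}{dz}=\theta\,\kappa\,N_0\,e^{\alpha_1\sqrt{1+A^2}-\beta_1A+\rho z},\qquad A(z_0)=x_0 .$$ (Then $Q_T(u)=A(Q_B(u))$ for $u$ near $u_0$ with $u\le p_m$ in the left problem and $u\ge p_m$ in the right problem.) In a neighbourhood of $z_0$, $$A(z)=\sum_{n=0}^\infty a_n(z-z_0)^n,$$ where $$a_n=\begin{cases}x_0,&n=0\\ \frac{N_0}{n}\,\theta\,\kappa\,d_{n-1},&n\ge1\end{cases},\qquad d_n=\begin{cases}e^{\alpha_1\sqrt{1+x_0^2}-\beta_1x_0+\rho z_0},&n=0\\ \frac1n\sum_{k=1}^nkc_kd_{n-k},&n\ge1\end{cases},$$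 $$b_n=\begin{cases}\sqrt{1+x_0^2},&n=0\\ \frac{1}{nb_0}\left(na_na_0+\sum_{k=0}^{n-2}(k+1)\left(a_{k+1}a_{n-k-1}-b_{k+1}b_{n-k-1}\right)\right),&n\ge1\end{cases},$$ $$c_n=\begin{cases}\alpha_1(b_1+\phi)+\beta_1(1-a_1),&n=1\\ \alpha_1b_n-\beta_1a_n,&n\ne1\end{cases}.$$
   Context: $K_\nu$ denotes the modified Bessel function of the second kind. The hyperbolic distribution $\mathrm{Hyp}(\alpha_1,\beta_1,1,0)$ has density $f_T(x)=\frac{\gamma_1}{2\alpha_1K_1(\gamma_1)}e^{-\alpha_1\sqrt{1+x^2}+\beta_1x}$ on $\mathbb{R}$; $F_T(x)=\int_{-\infty}^xf_T(t)\,dt$ and $Q_T=F_T^{-1}$. Let $x_m=\beta_1/\gamma_1$ (its mode), $p_m=F_T(x_m)$, $p_-=e^{-(\alpha_1+\beta_1)x_m}p_m$, $p_+=e^{(\alpha_1-\beta_1)x_m}(1-p_m)$. The base distribution has density $f_B(x)=p_-(\alpha_1+\beta_1)e^{(\alpha_1+\beta_1)x}$ for $x\le x_m$ and $f_B(x)=p_+(\alpha_1-\beta_1)e^{-(\alpha_1-\beta_1)x}$ for $x>x_m$, and quantile function $$Q_B(u)=\begin{cases}\frac{1}{\alpha_1+\beta_1}\ln\left(\frac{u}{p_-}\right),&u\le p_m\\-\frac{1}{\alpha_1-\beta_1}\ln\left(\frac{1-u}{p_+}\right),&u>p_m\end{cases}.$$ The function $A$ is defined by $Q_T=A\circ Q_B$;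 it satisfies $dA/dz=f_B(z)/f_T(A(z))$, which gives the left and right differential equations. Empty sums are zero. *)

theory Defs
  imports "HOL-Analysis.Analysis"
begin

(* Modified Bessel function of the second kind of real order, by the classical integral
   representation (DLMF 10.32.9). It is meaningful for x > 0 only; elsewhere the integrand is
   not integrable and the value is the library's default 0. *)
definition besselK :: "real \<Rightarrow> real \<Rightarrow> real" where
  "besselK \<nu> x = (LINT t:{0..}|lborel. exp (- x * cosh t) * cosh (\<nu> * t))"

definition gam :: "real \<Rightarrow> real \<Rightarrow> real" where
  "gam \<alpha> \<beta> = sqrt (\<alpha>\<^sup>2 - \<beta>\<^sup>2)"

definition N0 :: "real \<Rightarrow> real \<Rightarrow> real" where
  "N0 \<alpha> \<beta> = 2 * \<alpha> * besselK 1 (gam \<alpha> \<beta>) / gam \<alpha> \<beta>"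

definition f_T :: "real \<Rightarrow> real \<Rightarrow> real \<Rightarrow> real" where
  "f_T \<alpha> \<beta> x = gam \<alpha> \<beta> / (2 * \<alpha> * besselK 1 (gam \<alpha> \<beta>)) * exp (- \<alpha> * sqrt (1 + x\<^sup>2) + \<beta> * x)"

definition F_T :: "real \<Rightarrow> real \<Rightarrow> real \<Rightarrow> real" where
  "F_T \<alpha> \<beta> x = (LINT t:{..x}|lborel. f_T \<alpha> \<beta> t)"

(* Only evaluated on the range (0,1) of the strictly increasing function F_T. *)
definition Q_T :: "real \<Rightarrow> real \<Rightarrow> real \<Rightarrow> real" where
  "Q_T \<alpha> \<beta> = inv (F_T \<alpha> \<beta>)"

definition x_m :: "real \<Rightarrow> real \<Rightarrow> real" where
  "x_m \<alpha> \<beta> = \<beta> / gam \<alpha> \<beta>"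

definition p_m :: "real \<Rightarrow> real \<Rightarrow> real" where
  "p_m \<alpha> \<beta> = F_T \<alpha> \<beta> (x_m \<alpha> \<beta>)"

definition p_minus :: "real \<Rightarrow> real \<Rightarrow> real" where
  "p_minus \<alpha> \<beta> = exp (- (\<alpha> + \<beta>) * x_m \<alpha> \<beta>) * p_m \<alpha> \<beta>"

definition p_plus :: "real \<Rightarrow> real \<Rightarrow> real" where
  "p_plus \<alpha> \<beta> = exp ((\<alpha> - \<beta>) * x_m \<alpha> \<beta>) * (1 - p_m \<alpha> \<beta>)"

definition Q_B :: "real \<Rightarrow> real \<Rightarrow> real \<Rightarrow> real" where
  "Q_B \<alpha> \<beta> u =
     (if u \<le> p_m \<alpha> \<beta> then 1 / (\<alpha> + \<beta>) * ln (u / p_minus \<alpha> \<beta>)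
      else - 1 / (\<alpha> - \<beta>) * ln ((1 - u) / p_plus \<alpha> \<beta>))"

(* A is only constrained on some two-sided neighbourhood of z0. *)
definition solves_ivp ::
    "real \<Rightarrow> real \<Rightarrow> real \<Rightarrow> real \<Rightarrow> real \<Rightarrow> real \<Rightarrow> real \<Rightarrow> (real \<Rightarrow> real) \<Rightarrow> bool" where
  "solves_ivp \<alpha> \<beta> \<theta> \<rho> \<kappa> z0 x0 A \<longleftrightarrow>
     A z0 = x0 \<and>
     (\<forall>\<^sub>F z in nhds z0.
        (A has_real_derivative
           \<theta> * \<kappa> * N0 \<alpha> \<beta> * exp (\<alpha> * sqrt (1 + (A z)\<^sup>2) - \<beta> * A z + \<rho> * z)) (at z))"

context
  fixes \<alpha> \<beta> \<theta> \<phi> \<rho> \<kappa> z0 x0 :: real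
begin

(* The range k < n - 1 is k = 0, ..., n - 2, and is empty for n = 1; an upper limit n - 2 would be
   truncated to 0 on nat. *)
function coeff_a coeff_b coeff_c coeff_d :: "nat \<Rightarrow> real" where
  "coeff_a n = (if n = 0 then x0 else N0 \<alpha> \<beta> / real n * \<theta> * \<kappa> * coeff_d (n - 1))"
| "coeff_b n =
     (if n = 0 then sqrt (1 + x0\<^sup>2)
      else 1 / (real n * coeff_b 0) *
        (real n * coeff_a n * coeff_a 0 +
         (\<Sum>k<n - 1. real (k + 1) *
            (coeff_a (k + 1) * coeff_a (n - k - 1) - coeff_b (k + 1) * coeff_b (n - k - 1)))))"
| "coeff_c n =
     (if n = 1 then \<alpha> * (coeff_b 1 + \<phi>) + \<beta> * (1 - coeff_a 1)
      else \<alpha> * coeff_b n - \<beta> * coeff_a n)"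
| "coeff_d n =
     (if n = 0 then exp (\<alpha> * sqrt (1 + x0\<^sup>2) - \<beta> * x0 + \<rho> * z0)
      else 1 / real n * (\<Sum>k = 1..n. real k * coeff_c k * coeff_d (n - k)))"
  by pat_completeness auto
termination
  by (relation "Wellfounded.measure (case_sum (case_sum (\<lambda>n. 4 * n) (\<lambda>n. 4 * n + 1))
                                  (case_sum (\<lambda>n. 4 * n + 2) (\<lambda>n. 4 * n + 3)))") auto

declare coeff_a.simps [simp del] coeff_b.simps [simp del]
  coeff_c.simps [simp del] coeff_d.simps [simp del]

end

end

theory Submission
  imports Defs "HOL-Complex_Analysis.Complex_Analysis" "HOL-Probability.Sinc_Integral"
begin

text \<open>Multiplying the differential equation by \<open>f_T (A z)\<close> shows that \<open>F_T (A z) - \<phi> \<theta> exp (\<rho> z)\<close> is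
constant. As \<open>F_T\<close> is a strictly increasing bijection onto \<open>(0, 1)\<close> and \<open>\<phi> \<theta> exp (\<rho> z)\<close> is, up to an
additive constant, the inverse of \<open>Q_B\<close>, this yields both local uniqueness and \<open>Q_T = A \<circ> Q_B\<close>.
Analyticity comes from the complex domain: the equation is separable, so it is solved by a holomorphic
local inverse of a primitive. With \<open>B = sqrt (1 + A^2)\<close>, \<open>C = \<alpha> B - \<beta> A + \<rho> z\<close> and \<open>D = exp C\<close>, the
identities \<open>A' = \<theta> \<kappa> N0 D\<close>, \<open>B B' = A A'\<close> and \<open>D' = C' D\<close>, compared coefficientwise, are the
recursions for \<open>a\<close>, \<open>b\<close>, \<open>d\<close>; in particular the Taylor coefficients are real, and the sum of the
series on the real axis is a real solution.\<close>

subsection \<open>The hyperbolic distribution\<close>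

text \<open>The density without its constant. Keeping the constant apart lets the total mass be
  identified with \<open>N0\<close> before anything is known about the sign of
  \<open>besselK\<close>.\<close>

definition hyp_weight :: "real \<Rightarrow> real \<Rightarrow> real \<Rightarrow> real" where
  "hyp_weight \<alpha> \<beta> x = exp (- \<alpha> * sqrt (1 + x\<^sup>2) + \<beta> * x)"

lemma hyp_weight_pos [simp]: "hyp_weight \<alpha> \<beta> x > 0"
  by (simp add: hyp_weight_def)

lemma continuous_on_hyp_weight [continuous_intros]: "continuous_on S (hyp_weight \<alpha> \<beta>)"
  unfolding hyp_weight_def by (intro continuous_intros)

lemma borel_measurable_hyp_weight [measurable]: "hyp_weight \<alpha> \<beta> \<in> borel_measurable borel"
  by (intro borel_measurable_continuous_onI continuous_intros)

text \<open>Since \<open>sqrt (1 + x\<^sup>2)\<close> dominates |x|, the weight decays at least like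
  exp (- (\<alpha> - |\<beta>|) |x|), and the quadratic Taylor bound for exp then gives a multiple
  of the Cauchy density as majorant.\<close>

lemma integrable_hyp_weight:
  assumes "\<bar>\<beta>\<bar> < \<alpha>"
  shows "integrable lborel (hyp_weight \<alpha> \<beta>)"
proof -
  define c where "c = \<alpha> - \<bar>\<beta>\<bar>"
  have c: "c > 0" using assms by (simp add: c_def)
  have "integrable lborel (\<lambda>x::real. inverse (1 + x\<^sup>2))"
    using integrable_inverse_1_plus_square by (simp add: set_integrable_def)
  then have *: "integrable lborel (\<lambda>x::real. (1 + 2 / c\<^sup>2) * inverse (1 + x\<^sup>2))"
    by simp
  show ?thesis
  proof (rule Bochner_Integration.integrable_bound[OF *])
    have "hyp_weight \<alpha> \<beta> x \<le> (1 + 2 / c\<^sup>2) * inverse (1 + x\<^sup>2)" for x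
    proof -
      have "\<bar>x\<bar> \<le> sqrt (1 + x\<^sup>2)"
        by (rule real_le_rsqrt) simp
      then have "\<alpha> * \<bar>x\<bar> \<le> \<alpha> * sqrt (1 + x\<^sup>2)"
        using assms by (intro mult_left_mono) auto
      moreover have "\<beta> * x \<le> \<bar>\<beta>\<bar> * \<bar>x\<bar>"
        by (metis abs_ge_self abs_mult)
      ultimately have "- \<alpha> * sqrt (1 + x\<^sup>2) + \<beta> * x \<le> - (c * \<bar>x\<bar>)"
        by (simp add: c_def algebra_simps)
      then have 1: "hyp_weight \<alpha> \<beta> x \<le> inverse (exp (c * \<bar>x\<bar>))"
        by (simp add: hyp_weight_def flip: exp_minus)
      have "1 + c * \<bar>x\<bar> + (c * \<bar>x\<bar>)\<^sup>2 / 2 \<le> exp (c * \<bar>x\<bar>)"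
        using c by (intro exp_lower_Taylor_quadratic) auto
      then have "1 + c\<^sup>2 * x\<^sup>2 / 2 \<le> exp (c * \<bar>x\<bar>)"
        using c by (auto simp: power_mult_distrib intro: order_trans[rotated])
      \<comment> \<open>The factor is chosen so that the expanded product contains both 1 and
        \<open>x\<^sup>2\<close> with coefficient at least one.\<close>
      then have "(1 + 2 / c\<^sup>2) * (1 + c\<^sup>2 * x\<^sup>2 / 2) \<le> (1 + 2 / c\<^sup>2) * exp (c * \<bar>x\<bar>)"
        by (intro mult_left_mono add_nonneg_nonneg) auto
      moreover have "(1 + 2 / c\<^sup>2) * (1 + c\<^sup>2 * x\<^sup>2 / 2) = 1 + 2 / c\<^sup>2 + c\<^sup>2 * x\<^sup>2 / 2 + x\<^sup>2"
        using c by (simp add: field_simps)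
      ultimately have "1 + x\<^sup>2 \<le> (1 + 2 / c\<^sup>2) * exp (c * \<bar>x\<bar>)"
        using c by (smt (verit) divide_nonneg_nonneg mult_nonneg_nonneg zero_le_power2)
      then have 2: "inverse (exp (c * \<bar>x\<bar>)) \<le> (1 + 2 / c\<^sup>2) * inverse (1 + x\<^sup>2)"
        by (simp add: divide_simps add_pos_nonneg)
      show ?thesis using 1 2 by linarith
    qed
    then show "AE x in lborel. norm (hyp_weight \<alpha> \<beta> x) \<le> norm ((1 + 2 / c\<^sup>2) * inverse (1 + x\<^sup>2))"
      by (intro AE_I2) (smt (verit) hyp_weight_pos real_norm_def)
  qed auto
qed

text \<open>Writing \<open>\<alpha> = \<gamma> cosh t0\<close>, \<open>\<beta> = \<gamma> sinh t0\<close>, the substitution \<open>x = sinh (s + t0)\<close> turns the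
exponent into \<open>- \<gamma> cosh s\<close>, which is the exponent of the Bessel integral.\<close>

lemma hyp_weight_sinh:
  assumes "\<bar>\<beta>\<bar> < \<alpha>"
  defines "\<gamma> \<equiv> gam \<alpha> \<beta>" and "t0 \<equiv> arsinh (\<beta> / gam \<alpha> \<beta>)"
  shows "\<gamma> > 0" "\<gamma> * cosh t0 = \<alpha>" "hyp_weight \<alpha> \<beta> (sinh (s + t0)) = exp (- \<gamma> * cosh s)"
proof -
  have "\<beta>\<^sup>2 < \<alpha>\<^sup>2" using assms(1) by (metis abs_ge_zero power2_abs power_strict_mono zero_less_numeral)
  then show g: "\<gamma> > 0" by (simp add: \<gamma>_def gam_def)
  have g2: "\<gamma>\<^sup>2 = \<alpha>\<^sup>2 - \<beta>\<^sup>2" using \<open>\<beta>\<^sup>2 < \<alpha>\<^sup>2\<close> by (simp add: \<gamma>_def gam_def)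
  have sh: "\<gamma> * sinh t0 = \<beta>" using g by (simp add: t0_def \<gamma>_def)
  have "(\<gamma> * cosh t0)\<^sup>2 = \<gamma>\<^sup>2 + (\<gamma> * sinh t0)\<^sup>2"
    by (simp add: power_mult_distrib cosh_square_eq algebra_simps)
  also have "\<dots> = \<alpha>\<^sup>2" by (simp add: sh g2)
  finally show ch: "\<gamma> * cosh t0 = \<alpha>"
    using g assms(1) by (subst (asm) power2_eq_iff_nonneg) auto
  have "- \<alpha> * cosh (s + t0) + \<beta> * sinh (s + t0)
      = - \<gamma> * (cosh (s + t0) * cosh t0 - sinh (s + t0) * sinh t0)"
    unfolding ch[symmetric] sh[symmetric] by (simp add: algebra_simps)
  also have "cosh (s + t0) * cosh t0 - sinh (s + t0) * sinh t0 = cosh s"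
    using cosh_diff[of "s + t0" t0] by simp
  finally show "hyp_weight \<alpha> \<beta> (sinh (s + t0)) = exp (- \<gamma> * cosh s)"
    by (simp add: hyp_weight_def add.commute[of 1] flip: cosh_square_eq)
qed

text \<open>The map \<open>sinh (s + t0)\<close> is a bijection of the real line with positive
  derivative \<open>cosh (s + t0)\<close>, so one change of variables transfers both integrability
  and the value of the integral.\<close>

lemma hyp_weight_substitution:
  assumes "\<bar>\<beta>\<bar> < \<alpha>"
  defines "\<gamma> \<equiv> gam \<alpha> \<beta>" and "t0 \<equiv> arsinh (\<beta> / gam \<alpha> \<beta>)"
  shows "integrable lborel (\<lambda>s. cosh (s + t0) * exp (- \<gamma> * cosh s))"
    and "(LINT s|lborel. cosh (s + t0) * exp (- \<gamma> * cosh s)) = (LINT x|lborel. hyp_weight \<alpha> \<beta> x)"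
proof -
  let ?g = "\<lambda>s::real. sinh (s + t0)"
  have surj: "range ?g = UNIV"
  proof -
    have "x = ?g (arsinh x - t0)" for x by simp
    then show ?thesis by (metis surj_def)
  qed
  have inj: "inj ?g" by (auto simp: inj_on_def)
  \<comment> \<open>The substitution rule speaks of absolutely integrable functions and gauge
    integrals; \<open>absint\<close> and \<open>hk\<close> translate to and from
    \<open>lborel\<close>.\<close>
  have absint: "f absolutely_integrable_on UNIV \<longleftrightarrow> integrable lborel f"
    if "f \<in> borel_measurable borel" for f :: "real \<Rightarrow> real"
    using that by (simp add: set_integrable_def integrable_completion)
  have hk: "integral UNIV f = (LINT x|lborel. f x)" if "integrable lborel f" for f :: "real \<Rightarrow> real"
    using integral_lborel[OF that] by simp
  have "hyp_weight \<alpha> \<beta> absolutely_integrable_on UNIV"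
    using assms(1) by (simp add: absint integrable_hyp_weight)
  then have "(\<lambda>s. \<bar>cosh (s + t0)\<bar> * hyp_weight \<alpha> \<beta> (?g s)) absolutely_integrable_on UNIV \<and>
      integral UNIV (\<lambda>s. \<bar>cosh (s + t0)\<bar> * hyp_weight \<alpha> \<beta> (?g s)) = integral UNIV (hyp_weight \<alpha> \<beta>)"
    by (subst has_absolute_integral_change_of_variables_1'[where g = ?g])
       (use inj surj in \<open>auto intro!: derivative_eq_intros\<close>)
  moreover have "\<bar>cosh (s + t0)\<bar> * hyp_weight \<alpha> \<beta> (?g s) = cosh (s + t0) * exp (- \<gamma> * cosh s)" for s
    using hyp_weight_sinh(3)[OF assms(1)] by (simp add: \<gamma>_def t0_def)
  moreover have m: "(\<lambda>s. cosh (s + t0) * exp (- \<gamma> * cosh s)) \<in> borel_measurable borel"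
    by (intro borel_measurable_continuous_onI continuous_intros)
  ultimately have *: "integrable lborel (\<lambda>s. cosh (s + t0) * exp (- \<gamma> * cosh s))"
    "integral UNIV (\<lambda>s. cosh (s + t0) * exp (- \<gamma> * cosh s)) = integral UNIV (hyp_weight \<alpha> \<beta>)"
    by (simp_all add: absint)
  show "integrable lborel (\<lambda>s. cosh (s + t0) * exp (- \<gamma> * cosh s))" by fact
  show "(LINT s|lborel. cosh (s + t0) * exp (- \<gamma> * cosh s)) = (LINT x|lborel. hyp_weight \<alpha> \<beta> x)"
    using * hk[OF *(1)] hk[OF integrable_hyp_weight[OF assms(1)]] by simp
qed

text \<open>Reflection identifies the two half-lines, which overlap only in the null set {0}. Needed
  because \<open>besselK\<close> integrates over a half-line only.\<close>

lemma LINT_even: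
  fixes f :: "real \<Rightarrow> real"
  assumes f: "integrable lborel f" and even: "\<And>x. f (- x) = f x"
  shows "(LINT x|lborel. f x) = 2 * (LINT x:{0..}|lborel. f x)"
proof -
  have si: "set_integrable lborel S f" if "S \<in> sets borel" for S
    using f that unfolding set_integrable_def by (intro integrable_mult_indicator) auto
  have "(LINT x:{..0}|lborel. f x) = (LINT x|lborel. indicator {..0} (-x) *\<^sub>R f (-x))"
    unfolding set_lebesgue_integral_def
    by (subst lborel_integral_real_affine[where c = "-1" and t = 0]) auto
  also have "\<dots> = (LINT x:{0..}|lborel. f x)"
    unfolding set_lebesgue_integral_def
    by (intro Bochner_Integration.integral_cong) (auto simp: even indicator_def)
  finally have e: "(LINT x:{..0}|lborel. f x) = (LINT x:{0..}|lborel. f x)" .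
  have "(LINT x|lborel. f x) = (LINT x:{..0} \<union> {0..}|lborel. f x)"
    unfolding set_lebesgue_integral_def by (intro Bochner_Integration.integral_cong) (auto simp: indicator_def)
  also have "\<dots> = (LINT x:{..0}|lborel. f x) + (LINT x:{0..}|lborel. f x)"
  proof (rule set_integral_Un_AE)
    have "AE x in lborel. x \<noteq> (0::real)" by (rule AE_lborel_singleton)
    then show "AE x in lborel. \<not> (x \<in> {..0} \<and> x \<in> {(0::real)..})" by eventually_elim auto
  qed (auto intro: si)
  finally show ?thesis using e by simp
qed

text \<open>After the substitution, the addition theorem splits \<open>cosh (s + t0)\<close> into an
  even and an odd part. The odd part integrates to zero, the even one gives twice the Bessel
  integral, and \<open>cosh t0\<close> is \<alpha> / \<gamma>.\<close>

lemma integral_hyp_weight: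
  assumes "\<bar>\<beta>\<bar> < \<alpha>"
  shows "(LINT x|lborel. hyp_weight \<alpha> \<beta> x) = N0 \<alpha> \<beta>"
proof -
  define \<gamma> where "\<gamma> = gam \<alpha> \<beta>"
  define t0 where "t0 = arsinh (\<beta> / \<gamma>)"
  note hs = hyp_weight_sinh[OF assms, folded \<gamma>_def, folded t0_def]
  \<comment> \<open>The symmetric case, with \<gamma> and 0 in place of \<alpha> and \<beta>, has
    shift zero; there the substitution lemma yields integrability of the even part.\<close>
  have "gam \<gamma> 0 = \<gamma>" using hs(1) by (simp add: gam_def)
  then have ci: "integrable lborel (\<lambda>s. cosh s * exp (- \<gamma> * cosh s))"
    using hyp_weight_substitution(1)[of 0 \<gamma>] hs(1) by simp
  have si: "integrable lborel (\<lambda>s. sinh s * exp (- \<gamma> * cosh s))"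
  proof (rule Bochner_Integration.integrable_bound[OF ci])
    show "(\<lambda>s. sinh s * exp (- \<gamma> * cosh s)) \<in> borel_measurable lborel"
      by (simp, intro borel_measurable_continuous_onI continuous_intros)
    have "\<bar>sinh s\<bar> \<le> cosh s" for s :: real
      using sinh_le_cosh_real[of s] sinh_le_cosh_real[of "- s"] by (simp add: abs_le_iff)
    then show "AE s in lborel. norm (sinh s * exp (- \<gamma> * cosh s)) \<le> norm (cosh s * exp (- \<gamma> * cosh s))"
      by (intro AE_I2) (simp add: abs_mult)
  qed
  have "(LINT x|lborel. hyp_weight \<alpha> \<beta> x) = (LINT s|lborel. cosh (s + t0) * exp (- \<gamma> * cosh s))"
    using hyp_weight_substitution(2)[OF assms] by (simp add: \<gamma>_def t0_def)
  also have "\<dots> = (LINT s|lborel. cosh t0 * (cosh s * exp (- \<gamma> * cosh s)) + sinh t0 * (sinh s * exp (- \<gamma> * cosh s)))"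
    by (intro Bochner_Integration.integral_cong) (auto simp: cosh_add algebra_simps)
  also have "\<dots> = cosh t0 * (LINT s|lborel. cosh s * exp (- \<gamma> * cosh s))
                + sinh t0 * (LINT s|lborel. sinh s * exp (- \<gamma> * cosh s))"
    using ci si by (subst Bochner_Integration.integral_add) simp_all
  \<comment> \<open>Reflecting s turns this integral into its own negative.\<close>
  also have "(LINT s|lborel. sinh s * exp (- \<gamma> * cosh s)) = 0"
    using lborel_integral_real_affine[of "-1" "\<lambda>s. sinh s * exp (- \<gamma> * cosh s)" 0] by simp
  also have "(LINT s|lborel. cosh s * exp (- \<gamma> * cosh s)) = 2 * besselK 1 \<gamma>"
    using LINT_even[OF ci] by (simp add: besselK_def mult.commute)
  also have "cosh t0 = \<alpha> / \<gamma>" using hs(1,2) by (simp add: field_simps)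
  finally show ?thesis by (simp add: N0_def \<gamma>_def field_simps)
qed

text \<open>As the integral of a strictly positive function, \<open>N0\<close> cannot vanish:
  otherwise the weight would be zero almost everywhere.\<close>

lemma N0_pos:
  assumes "\<bar>\<beta>\<bar> < \<alpha>"
  shows "N0 \<alpha> \<beta> > 0"
proof -
  have "N0 \<alpha> \<beta> \<noteq> 0"
  proof
    assume "N0 \<alpha> \<beta> = 0"
    then have "(LINT x|lborel. hyp_weight \<alpha> \<beta> x) = 0" using integral_hyp_weight[OF assms] by simp
    then have "AE x in lborel. hyp_weight \<alpha> \<beta> x = 0"
      by (subst (asm) integral_nonneg_eq_0_iff_AE)
         (use integrable_hyp_weight[OF assms] less_imp_le[OF hyp_weight_pos] in auto)
    then have "AE x::real in lborel. False"
      by eventually_elim (metis hyp_weight_pos less_irrefl)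
    then show False by (simp add: eventually_False ae_filter_eq_bot_iff)
  qed
  moreover have "N0 \<alpha> \<beta> \<ge> 0"
    unfolding integral_hyp_weight[OF assms, symmetric]
    by (intro Bochner_Integration.integral_nonneg less_imp_le hyp_weight_pos)
  ultimately show ?thesis by simp
qed

section \<open>The distribution function as a strictly increasing bijection onto the open unit
  interval\<close>

lemma f_T_eq: "f_T \<alpha> \<beta> x = hyp_weight \<alpha> \<beta> x / N0 \<alpha> \<beta>"
  by (simp add: f_T_def N0_def hyp_weight_def)

lemma f_T_pos:
  assumes "\<bar>\<beta>\<bar> < \<alpha>"
  shows "f_T \<alpha> \<beta> x > 0"
  using N0_pos[OF assms] by (simp add: f_T_eq)

lemma set_integrable_f_T:
  assumes "\<bar>\<beta>\<bar> < \<alpha>" "S \<in> sets borel"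
  shows "set_integrable lborel S (f_T \<alpha> \<beta>)"
proof -
  have "integrable lborel (f_T \<alpha> \<beta>)"
    using integrable_hyp_weight[OF assms(1)] by (simp add: f_T_eq[abs_def])
  then show ?thesis
    using assms(2) unfolding set_integrable_def by (intro integrable_mult_indicator) auto
qed

text \<open>Replaces the half-line by a compact interval and the Lebesgue integral by the gauge
  integral, the setting of the fundamental theorem of calculus.\<close>

lemma F_T_diff:
  assumes "\<bar>\<beta>\<bar> < \<alpha>" "a \<le> x"
  shows "F_T \<alpha> \<beta> x = F_T \<alpha> \<beta> a + integral {a..x} (f_T \<alpha> \<beta>)"
proof -
  note si = set_integrable_f_T[OF assms(1)]
  have "{..x} = {..a} \<union> {a..x}"
    using assms(2) by auto
  then have "F_T \<alpha> \<beta> x = (LINT t:{..a} \<union> {a..x}|lborel. f_T \<alpha> \<beta> t)"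
    by (simp add: F_T_def)
  also have "\<dots> = F_T \<alpha> \<beta> a + (LINT t:{a..x}|lborel. f_T \<alpha> \<beta> t)"
    unfolding F_T_def
  proof (rule set_integral_Un_AE)
    have "AE t in lborel. t \<noteq> a" by (rule AE_lborel_singleton)
    then show "AE t in lborel. \<not> (t \<in> {..a} \<and> t \<in> {a..x})" by eventually_elim auto
  qed (auto intro: si)
  also have "(LINT t:{a..x}|lborel. f_T \<alpha> \<beta> t) = integral {a..x} (f_T \<alpha> \<beta>)"
    by (intro set_borel_integral_eq_integral si) auto
  finally show ?thesis .
qed

lemma F_T_has_real_derivative:
  assumes "\<bar>\<beta>\<bar> < \<alpha>"
  shows "(F_T \<alpha> \<beta> has_real_derivative f_T \<alpha> \<beta> x) (at x)"
proof -
  \<comment> \<open>A window with x in its interior: the base point x - 1 makes the fundamental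
    theorem applicable, and the derivative within the window is the full derivative.\<close>
  have "continuous_on {x - 1..x + 1} (f_T \<alpha> \<beta>)"
    unfolding f_T_eq[abs_def] using N0_pos[OF assms] by (intro continuous_intros) auto
  then have "((\<lambda>y. F_T \<alpha> \<beta> (x - 1) + integral {x - 1..y} (f_T \<alpha> \<beta>)) has_real_derivative f_T \<alpha> \<beta> x)
      (at x within {x - 1..x + 1})"
    by (auto intro!: derivative_eq_intros integral_has_real_derivative)
  then have "(F_T \<alpha> \<beta> has_real_derivative f_T \<alpha> \<beta> x) (at x within {x - 1..x + 1})"
    by (rule has_field_derivative_transform_within[OF _ zero_less_one])
       (auto simp: F_T_diff[OF assms])
  moreover have "at x within {x - 1..x + 1} = at x"
    by (rule at_within_interior) auto
  ultimately show ?thesis by simp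
qed

lemma strict_mono_F_T:
  assumes "\<bar>\<beta>\<bar> < \<alpha>"
  shows "strict_mono (F_T \<alpha> \<beta>)"
proof (rule strict_monoI)
  fix x y :: real assume "x < y"
  then show "F_T \<alpha> \<beta> x < F_T \<alpha> \<beta> y"
    using F_T_has_real_derivative[OF assms] f_T_pos[OF assms] DERIV_pos_imp_increasing by blast
qed

lemma F_T_at_top:
  assumes "\<bar>\<beta>\<bar> < \<alpha>"
  shows "(F_T \<alpha> \<beta> \<longlongrightarrow> 1) at_top"
proof -
  have i: "integrable lborel (f_T \<alpha> \<beta>)"
    using integrable_hyp_weight[OF assms] by (simp add: f_T_eq[abs_def])
  have "(LINT x|lborel. f_T \<alpha> \<beta> x) = 1"
    using integral_hyp_weight[OF assms] N0_pos[OF assms] by (simp add: f_T_eq)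
  then show ?thesis
    using tendsto_integral_at_top[OF _ i] by (simp add: F_T_def[abs_def] set_lebesgue_integral_def)
qed

text \<open>For a below 0, \<open>F_T\<close> at a is \<open>F_T\<close> at 0 minus the mass of
  [a, 0], and that mass tends to the mass of the whole left half-line.\<close>

lemma F_T_at_bot:
  assumes "\<bar>\<beta>\<bar> < \<alpha>"
  shows "(F_T \<alpha> \<beta> \<longlongrightarrow> 0) at_bot"
proof -
  have "((\<lambda>a. LINT t:{a..0}|lborel. f_T \<alpha> \<beta> t) \<longlongrightarrow> (LINT t:{..0}|lborel. f_T \<alpha> \<beta> t)) at_bot"
    by (intro tendsto_set_lebesgue_integral_at_bot set_integrable_f_T assms) auto
  then have "((\<lambda>a. F_T \<alpha> \<beta> 0 - (LINT t:{a..0}|lborel. f_T \<alpha> \<beta> t)) \<longlongrightarrow> F_T \<alpha> \<beta> 0 - F_T \<alpha> \<beta> 0) at_bot"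
    by (intro tendsto_diff tendsto_const) (simp add: F_T_def)
  moreover have "eventually (\<lambda>a. F_T \<alpha> \<beta> 0 - (LINT t:{a..0}|lborel. f_T \<alpha> \<beta> t) = F_T \<alpha> \<beta> a) at_bot"
    using eventually_le_at_bot[of 0]
  proof eventually_elim
    case (elim a)
    have "(LINT t:{a..0}|lborel. f_T \<alpha> \<beta> t) = integral {a..0} (f_T \<alpha> \<beta>)"
      by (intro set_borel_integral_eq_integral set_integrable_f_T assms) auto
    then show ?case using F_T_diff[OF assms elim] by simp
  qed
  ultimately show ?thesis by (simp add: tendsto_cong)
qed

lemma range_F_T:
  assumes "\<bar>\<beta>\<bar> < \<alpha>"
  shows "range (F_T \<alpha> \<beta>) = {0<..<1}"
proof (intro antisym subsetI)
  fix u assume "u \<in> range (F_T \<alpha> \<beta>)"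
  then obtain x where x: "u = F_T \<alpha> \<beta> x" by auto
  note mono = strict_mono_F_T[OF assms]
  \<comment> \<open>The limits give only weak bounds. Taking them at x - 1 and x + 1 lets strict
    monotonicity make the bounds at x strict.\<close>
  have "0 \<le> F_T \<alpha> \<beta> (x - 1)"
    by (rule tendsto_upperbound[OF F_T_at_bot[OF assms]])
       (use mono eventually_le_at_bot[of "x - 1"] in \<open>auto elim!: eventually_mono simp: strict_mono_less_eq\<close>)
  moreover have "F_T \<alpha> \<beta> (x + 1) \<le> 1"
    by (rule tendsto_lowerbound[OF F_T_at_top[OF assms]])
       (use mono eventually_ge_at_top[of "x + 1"] in \<open>auto elim!: eventually_mono simp: strict_mono_less_eq\<close>)
  moreover have "F_T \<alpha> \<beta> (x - 1) < F_T \<alpha> \<beta> x" "F_T \<alpha> \<beta> x < F_T \<alpha> \<beta> (x + 1)"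
    using mono by (auto simp: strict_mono_less)
  ultimately show "u \<in> {0<..<1}" by (simp add: x)
next
  fix u :: real assume u: "u \<in> {0<..<1}"
  have "eventually (\<lambda>x. F_T \<alpha> \<beta> x < u) at_bot"
    using order_tendstoD(2)[OF F_T_at_bot[OF assms]] u by auto
  then obtain a where a: "F_T \<alpha> \<beta> a < u" by (auto simp: eventually_at_bot_linorder)
  have "eventually (\<lambda>x. u < F_T \<alpha> \<beta> x) at_top"
    using order_tendstoD(1)[OF F_T_at_top[OF assms]] u by auto
  then obtain b where b: "u < F_T \<alpha> \<beta> b" by (auto simp: eventually_at_top_linorder)
  have "a \<le> b"
    using a b strict_mono_less_eq[OF strict_mono_F_T[OF assms]] by (meson less_le_trans less_imp_le order.strict_trans not_le)
  then obtain x where "F_T \<alpha> \<beta> x = u"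
    using IVT[of "F_T \<alpha> \<beta>" a u b] a b F_T_has_real_derivative[OF assms]
    by (auto dest: DERIV_isCont)
  then show "u \<in> range (F_T \<alpha> \<beta>)" by auto
qed

lemma Q_T_F_T:
  assumes "\<bar>\<beta>\<bar> < \<alpha>"
  shows "Q_T \<alpha> \<beta> (F_T \<alpha> \<beta> x) = x"
  unfolding Q_T_def using strict_mono_imp_inj_on[OF strict_mono_F_T[OF assms]] by (rule inv_f_f)

lemma F_T_Q_T:
  assumes "\<bar>\<beta>\<bar> < \<alpha>" "0 < u" "u < 1"
  shows "F_T \<alpha> \<beta> (Q_T \<alpha> \<beta> u) = u"
  unfolding Q_T_def by (rule f_inv_into_f) (use assms range_F_T[OF assms(1)] in auto)

subsection \<open>The coefficient recursion\<close>

text \<open>The last summand of the Cauchy product is split off because it alone involves the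
  coefficient of index m + 1, the unknown of the recursion for b.\<close>

lemma fps_mult_deriv_self_nth_Suc:
  fixes f :: "'a :: comm_ring_1 fps"
  shows "fps_nth (fps_deriv f * f) m =
    (\<Sum>k<m. of_nat (k + 1) * (fps_nth f (k + 1) * fps_nth f (m - k))) + of_nat (m + 1) * fps_nth f (m + 1) * fps_nth f 0"
  by (simp add: fps_mult_nth atLeast0AtMost flip: lessThan_Suc_atMost) (simp add: mult.assoc)

text \<open>The four sequences are identified together by strong induction. The relation between
  \<rho> and \<phi> treats the left and right problems at once and explains the special form of
  \<open>coeff_c\<close> at 1.\<close>

lemma fps_nth_eq_coeff:
  fixes fa fb fc fd :: "complex fps" and \<alpha> \<beta> \<theta> \<phi> \<rho> \<kappa> z0 x0 :: real
  assumes \<rho>: "\<rho> = \<alpha> * \<phi> + \<beta>"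
    and fa0: "fps_nth fa 0 = of_real x0"
    and fb0: "fps_nth fb 0 = of_real (sqrt (1 + x0\<^sup>2))"
    and fd0: "fps_nth fd 0 = of_real (exp (\<alpha> * sqrt (1 + x0\<^sup>2) - \<beta> * x0 + \<rho> * z0))"
    and fa: "fps_deriv fa = fps_const (of_real (\<theta> * \<kappa> * N0 \<alpha> \<beta>)) * fd"
    and fb: "fb * fb = 1 + fa * fa"
    and fc: "fc = fps_const (of_real \<alpha>) * fb - fps_const (of_real \<beta>) * fa
               + fps_const (of_real \<rho>) * (fps_const (of_real z0) + fps_X)"
    and fd: "fps_deriv fd = fps_deriv fc * fd"
  shows "fps_nth fa n = of_real (coeff_a \<alpha> \<beta> \<theta> \<phi> \<rho> \<kappa> z0 x0 n)"
proof -
  let ?a = "coeff_a \<alpha> \<beta> \<theta> \<phi> \<rho> \<kappa> z0 x0" and ?b = "coeff_b \<alpha> \<beta> \<theta> \<phi> \<rho> \<kappa> z0 x0"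
    and ?c = "coeff_c \<alpha> \<beta> \<theta> \<phi> \<rho> \<kappa> z0 x0" and ?d = "coeff_d \<alpha> \<beta> \<theta> \<phi> \<rho> \<kappa> z0 x0"
  have "fps_deriv (fb * fb) = fps_deriv (1 + fa * fa)"
    by (simp only: fb)
  then have "2 * (fps_deriv fb * fb) = 2 * (fps_deriv fa * fa)"
    by (simp add: algebra_simps)
  then have fb': "fps_deriv fb * fb = fps_deriv fa * fa"
    by simp
  have b0: "?b 0 = sqrt (1 + x0\<^sup>2)" by (simp add: coeff_b.simps)
  have b0_pos: "?b 0 > 0" unfolding b0 by (simp add: add_pos_nonneg)
  \<comment> \<open>Index 0 is excluded for c: the constant term of \<open>fc\<close> contains
    \<rho> z0, which \<open>coeff_c\<close> at 0 lacks, and the recursion for d starts at index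
    1.\<close>
  have "fps_nth fa n = of_real (?a n) \<and> fps_nth fb n = of_real (?b n) \<and>
        fps_nth fd n = of_real (?d n) \<and> (n > 0 \<longrightarrow> fps_nth fc n = of_real (?c n))"
  proof (induction n rule: less_induct)
    case (less n)
    show ?case
    proof (cases n)
      case 0
      then show ?thesis
        by (simp add: fa0 fb0 fd0 coeff_a.simps coeff_b.simps coeff_d.simps)
    next
      case (Suc m)
      have IHa: "fps_nth fa k = of_real (?a k)" and IHb: "fps_nth fb k = of_real (?b k)"
        and IHd: "fps_nth fd k = of_real (?d k)" if "k \<le> m" for k
        using less.IH[of k] that Suc by auto
      have IHc: "fps_nth fc k = of_real (?c k)" if "0 < k" "k \<le> m" for k
        using less.IH[of k] that Suc by auto
      \<comment> \<open>Within one index the order is forced: a comes from d at index m, then b from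
        a, c from both, and finally d.\<close>
      have "of_nat (m + 1) * fps_nth fa (m + 1) = fps_nth (fps_deriv fa) m"
        by simp
      also have "\<dots> = of_real (\<theta> * \<kappa> * N0 \<alpha> \<beta> * ?d m)"
        by (simp add: fa IHd)
      also have "\<dots> = of_nat (m + 1) * of_real (?a (m + 1))"
        unfolding coeff_a.simps[of _ _ _ _ _ _ _ _ "m + 1"]
        by (simp del: of_nat_Suc)
      finally have an: "fps_nth fa n = of_real (?a n)"
        using Suc by (simp del: of_nat_Suc)
      \<comment> \<open>Coefficient m of the identity B B' = A A'. Its sums involve only indices up
        to m, so the induction hypothesis evaluates them, and the equation can be solved for the new
        coefficient of B.\<close>
      have eq: "(\<Sum>k<m. of_nat (k + 1) * (fps_nth fb (k + 1) * fps_nth fb (m - k))) + of_nat (m + 1) * fps_nth fb (m + 1) * fps_nth fb 0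
           = (\<Sum>k<m. of_nat (k + 1) * (fps_nth fa (k + 1) * fps_nth fa (m - k))) + of_nat (m + 1) * fps_nth fa (m + 1) * fps_nth fa 0"
        using arg_cong[OF fb', of "\<lambda>f. fps_nth f m"] unfolding fps_mult_deriv_self_nth_Suc .
      define Sa where "Sa = (\<Sum>k<m. real (k + 1) * (?a (k + 1) * ?a (m - k)))"
      define Sb where "Sb = (\<Sum>k<m. real (k + 1) * (?b (k + 1) * ?b (m - k)))"
      have sb: "(\<Sum>k<m. of_nat (k + 1) * (fps_nth fb (k + 1) * fps_nth fb (m - k))) = of_real Sb"
        unfolding of_real_sum Sb_def by (intro sum.cong refl) (simp add: IHb)
      have sa: "(\<Sum>k<m. of_nat (k + 1) * (fps_nth fa (k + 1) * fps_nth fa (m - k))) = of_real Sa"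
        unfolding of_real_sum Sa_def by (intro sum.cong refl) (simp add: IHa)
      have "?b n = 1 / (real n * ?b 0) * (real n * ?a n * ?a 0 +
         (\<Sum>k<n - 1. real (k + 1) * (?a (k + 1) * ?a (n - k - 1) - ?b (k + 1) * ?b (n - k - 1))))"
        using Suc by (subst coeff_b.simps) (rule if_not_P, simp)
      then have "real n * ?b 0 * ?b n = real n * ?a n * ?a 0 +
         (\<Sum>k<n - 1. real (k + 1) * (?a (k + 1) * ?a (n - k - 1) - ?b (k + 1) * ?b (n - k - 1)))"
        using Suc b0_pos by (simp only: mult_1 times_divide_eq_left times_divide_eq_right nonzero_mult_div_cancel_left) simp
      also have "\<dots> = real n * ?a n * ?a 0 + Sa - Sb"
        using Suc by (simp add: right_diff_distrib sum_subtractf Sa_def Sb_def)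
      finally have "of_real (real n * ?b 0 * ?b n) = of_nat n * fps_nth fa n * fps_nth fa 0 + of_real Sa - (of_real Sb :: complex)"
        by (simp only: an IHa of_real_add of_real_diff of_real_mult of_real_of_nat_eq)
      also have "\<dots> = of_nat n * fps_nth fb n * fps_nth fb 0"
        using eq Suc unfolding sa sb by (simp add: diff_eq_eq add_ac del: of_nat_Suc)
      finally have "of_real (real n * ?b 0 * ?b n) = (of_nat n * fps_nth fb n * fps_nth fb 0 :: complex)" .
      then have "(of_nat n * of_real (?b 0)) * fps_nth fb n = (of_nat n * of_real (?b 0)) * (of_real (?b n) :: complex)"
        unfolding IHb[OF le0] of_real_mult of_real_of_nat_eq by (simp only: mult_ac)
      moreover have "of_nat n * of_real (?b 0) \<noteq> (0 :: complex)"
        using Suc b0_pos by (simp del: of_nat_Suc)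
      ultimately have bn: "fps_nth fb n = of_real (?b n)"
        using mult_left_cancel by blast
      have "fps_nth fc n = of_real \<alpha> * fps_nth fb n - of_real \<beta> * fps_nth fa n + (if n = 1 then of_real \<rho> else 0)"
        using Suc by (simp add: fc)
      moreover have "?c n = (if n = 1 then \<alpha> * (?b 1 + \<phi>) + \<beta> * (1 - ?a 1) else \<alpha> * ?b n - \<beta> * ?a n)"
        by (rule coeff_c.simps)
      ultimately have cn: "fps_nth fc n = of_real (?c n)"
        by (simp add: an bn) (simp add: \<rho> algebra_simps)
      have IHc': "fps_nth fc k = of_real (?c k)" if "0 < k" "k \<le> n" for k
        using IHc[of k] cn that Suc by (cases "k = n") auto
      have "of_nat n * fps_nth fd n = fps_nth (fps_deriv fd) m"
        using Suc by simp
      \<comment> \<open>Coefficient m of C' D; moving the index up by one gives the range 1 to n of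
        the recursion.\<close>
      also have "\<dots> = (\<Sum>k=0..m. of_nat (Suc k) * fps_nth fc (Suc k) * fps_nth fd (n - Suc k))"
        unfolding fd by (simp add: fps_mult_nth Suc)
      also have "\<dots> = (\<Sum>k=1..n. of_nat k * fps_nth fc k * fps_nth fd (n - k))"
        unfolding Suc One_nat_def by (rule sum.atLeast_Suc_atMost_Suc_shift[symmetric, unfolded o_def])
      also have "\<dots> = of_real (\<Sum>k=1..n. real k * ?c k * ?d (n - k))"
        unfolding of_real_sum using Suc by (intro sum.cong refl) (auto simp: IHc' IHd)
      also have "(\<Sum>k=1..n. real k * ?c k * ?d (n - k)) = real n * ?d n"
        using Suc by (subst (2) coeff_d.simps) (simp del: of_nat_Suc)
      finally have "fps_nth fd n = of_real (?d n)"
        using Suc by (simp del: of_nat_Suc)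
      then show ?thesis using an bn cn by simp
    qed
  qed
  then show ?thesis by simp
qed

subsection \<open>Holomorphic solution of the initial value problem\<close>

text \<open>With F a primitive of f, the equation f(A) A' = g integrates to F(A(z)) = G(z) - G(z0) +
  F(x0). Because F' = f has no zero, F is invertible near x0, and applying the inverse gives
  A.\<close>

lemma separable_ode_holomorphic_solution:
  fixes f g G :: "complex \<Rightarrow> complex"
  assumes "r > 0" and f: "f holomorphic_on ball x0 r" "\<And>x. x \<in> ball x0 r \<Longrightarrow> f x \<noteq> 0"
    and G: "\<And>z. (G has_field_derivative g z) (at z)"
  obtains e A where "e > 0" "A z0 = x0" "A holomorphic_on ball z0 e"
    "\<And>z. z \<in> ball z0 e \<Longrightarrow> A z \<in> ball x0 r"
    "\<And>z. z \<in> ball z0 e \<Longrightarrow> (A has_field_derivative g z / f (A z)) (at z)"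
proof -
  obtain F where F: "\<And>x. x \<in> ball x0 r \<Longrightarrow> (F has_field_derivative f x) (at x within ball x0 r)"
    using holomorphic_convex_primitive'[OF convex_ball open_ball f(1)] by blast
  have F': "(F has_field_derivative f x) (at x)" if "x \<in> ball x0 r" for x
    using F[OF that] that by (simp add: at_within_open[OF _ open_ball])
  have holF: "F holomorphic_on ball x0 r"
    using F' holomorphic_on_open[OF open_ball] by blast
  have x0: "x0 \<in> ball x0 r" using \<open>r > 0\<close> by simp
  have "deriv F x0 \<noteq> 0"
    using DERIV_imp_deriv[OF F'[OF x0]] f(2)[OF x0] by simp
  then obtain s where s: "s > 0" "ball x0 s \<subseteq> ball x0 r" "open (F ` ball x0 s)" "inj_on F (ball x0 s)"
    using has_complex_derivative_locally_invertible[OF holF x0 open_ball] by blast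
  obtain h where h: "h holomorphic_on F ` ball x0 s"
      "\<And>z. z \<in> ball x0 s \<Longrightarrow> deriv F z * deriv h (F z) = 1"
      "\<And>z. z \<in> ball x0 s \<Longrightarrow> h (F z) = z"
    using holomorphic_has_inverse[OF holomorphic_on_subset[OF holF s(2)] open_ball s(4)] by blast
  define H where "H z = G z - G z0 + F x0" for z
  have H: "(H has_field_derivative g z) (at z)" for z
    unfolding H_def by (auto intro!: derivative_eq_intros G)
  \<comment> \<open>Shrinks the disc around z0 until \<open>H\<close> maps it into the open image on
    which the inverse \<open>h\<close> is defined.\<close>
  have "open (H -` (F ` ball x0 s))"
    using H s(3) by (intro open_vimage) (auto intro!: continuous_at_imp_continuous_on DERIV_isCont)
  moreover have "z0 \<in> H -` (F ` ball x0 s)"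
    using s(1) by (simp add: H_def)
  ultimately obtain e where e: "e > 0" "ball z0 e \<subseteq> H -` (F ` ball x0 s)"
    using open_contains_ball by blast
  have mem: "\<exists>x\<in>ball x0 s. H z = F x \<and> h (H z) = x" if "z \<in> ball z0 e" for z
    using e(2) that h(3) by fastforce
  have der: "((h \<circ> H) has_field_derivative g z / f ((h \<circ> H) z)) (at z)" if z: "z \<in> ball z0 e" for z
  proof -
    obtain x where x: "x \<in> ball x0 s" "H z = F x" "h (H z) = x" using mem[OF z] by blast
    have "(h has_field_derivative deriv h (H z)) (at (H z))"
      using h(1) s(3) x by (intro holomorphic_derivI[of _ "F ` ball x0 s"]) auto
    moreover have "deriv h (H z) = 1 / f x"
      using h(2)[OF x(1)] DERIV_imp_deriv[OF F', of x] x s(2) f(2)[of x] by (auto simp: field_simps)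
    ultimately show ?thesis
      using DERIV_chain[of h "1 / f x" H z, OF _ H[of z]] x by simp
  qed
  show ?thesis
  proof
    show "(h \<circ> H) z0 = x0" using h(3) s(1) by (simp add: H_def)
    show "h \<circ> H holomorphic_on ball z0 e"
      using der holomorphic_on_open[OF open_ball] by blast
    show "(h \<circ> H) z \<in> ball x0 r" if "z \<in> ball z0 e" for z
      using mem[OF that] s(2) by auto
    show "((h \<circ> H) has_field_derivative g z / f ((h \<circ> H) z)) (at z)" if "z \<in> ball z0 e" for z
      by (rule der[OF that])
  qed (use e in auto)
qed

text \<open>In the strip the real part of \<open>1 + w\<^sup>2\<close> stays positive, which keeps
  the principal square root away from its branch cut.\<close>

lemma one_plus_square_not_nonpos:
  fixes w :: complex
  assumes "\<bar>Im w\<bar> < 1"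
  shows "1 + w\<^sup>2 \<notin> \<real>\<^sub>\<le>\<^sub>0"
proof -
  have "(Im w)\<^sup>2 < 1"
    using assms by (simp add: abs_square_less_1)
  then have "Re (1 + w\<^sup>2) > 0"
    using zero_le_power2[of "Re w"] unfolding plus_complex.sel one_complex.sel Re_power2 by linarith
  then show ?thesis by (auto simp: complex_nonpos_Reals_iff)
qed

text \<open>The factor depending on A moves to the left side as its reciprocal \<open>f\<close>,
  leaving \<open>g\<close> with primitive K exp (\<rho> z) / \<rho>. The bound on the imaginary part
  is recorded so that the square root can later be composed with A.\<close>

lemma complex_ivp_solution:
  fixes \<alpha> \<beta> \<rho> K x0 z0 :: real
  assumes "\<rho> \<noteq> 0"
  obtains e :: real and A :: "complex \<Rightarrow> complex"
  where "e > 0" "A (of_real z0) = of_real x0" "A holomorphic_on ball (of_real z0) e"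
    "\<And>z. z \<in> ball (of_real z0) e \<Longrightarrow> \<bar>Im (A z)\<bar> < 1"
    "\<And>z. z \<in> ball (of_real z0) e \<Longrightarrow>
       (A has_field_derivative of_real K * exp (of_real \<alpha> * csqrt (1 + (A z)\<^sup>2) - of_real \<beta> * A z + of_real \<rho> * z)) (at z)"
proof -
  define f where "f w = exp (- of_real \<alpha> * csqrt (1 + w\<^sup>2) + of_real \<beta> * w)" for w
  define g where "g z = of_real K * exp (of_real \<rho> * z)" for z :: complex
  have Im: "\<bar>Im w\<bar> < 1" if "w \<in> ball (of_real x0) 1" for w
    using abs_Im_le_cmod[of "of_real x0 - w"] that by (auto simp: dist_norm)
  have f: "f holomorphic_on ball (of_real x0) 1"
    unfolding f_def using one_plus_square_not_nonpos[OF Im]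
    by (intro holomorphic_intros) auto
  have G: "((\<lambda>z. of_real K / of_real \<rho> * exp (of_real \<rho> * z)) has_field_derivative g z) (at z)" for z
    unfolding g_def using assms by (auto intro!: derivative_eq_intros)
  have f0: "f w \<noteq> 0" for w by (simp add: f_def)
  obtain A e where A: "e > 0" "A (of_real z0) = of_real x0" "A holomorphic_on ball (of_real z0) e"
    "\<And>z. z \<in> ball (of_real z0) e \<Longrightarrow> A z \<in> ball (of_real x0) 1"
    "\<And>z. z \<in> ball (of_real z0) e \<Longrightarrow> (A has_field_derivative g z / f (A z)) (at z)"
    by (rule separable_ode_holomorphic_solution[OF zero_less_one f f0 G, of "of_real z0"]) (rule that)
  have "g z / f w = of_real K * exp (of_real \<alpha> * csqrt (1 + w\<^sup>2) - of_real \<beta> * w + of_real \<rho> * z)" for z w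
  proof -
    have "exp (of_real \<rho> * z) / f w = exp (of_real \<rho> * z - (- of_real \<alpha> * csqrt (1 + w\<^sup>2) + of_real \<beta> * w))"
      unfolding f_def by (rule exp_diff[symmetric])
    moreover have "of_real \<rho> * z - (- of_real \<alpha> * csqrt (1 + w\<^sup>2) + of_real \<beta> * w)
        = of_real \<alpha> * csqrt (1 + w\<^sup>2) - of_real \<beta> * w + of_real \<rho> * z"
      by simp
    ultimately show ?thesis by (simp only: g_def flip: times_divide_eq_right)
  qed
  then show ?thesis
    using that[OF A(1-3) Im[OF A(4)]] A(5) by simp
qed

text \<open>Recentring at 0 makes A, B, C and D holomorphic functions of the displacement w. Their
  differential and algebraic identities become identities of power series by uniqueness of
  expansions.\<close>

lemma complex_ivp_coeffs:
  fixes A :: "complex \<Rightarrow> complex" and \<alpha> \<beta> \<theta> \<phi> \<rho> \<kappa> x0 z0 :: real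
  assumes \<rho>: "\<rho> = \<alpha> * \<phi> + \<beta>" and e: "e > 0"
    and A0: "A (of_real z0) = of_real x0" and holA: "A holomorphic_on ball (of_real z0) e"
    and Im: "\<And>z. z \<in> ball (of_real z0) e \<Longrightarrow> \<bar>Im (A z)\<bar> < 1"
    and A': "\<And>z. z \<in> ball (of_real z0) e \<Longrightarrow> (A has_field_derivative
       of_real (\<theta> * \<kappa> * N0 \<alpha> \<beta>) * exp (of_real \<alpha> * csqrt (1 + (A z)\<^sup>2) - of_real \<beta> * A z + of_real \<rho> * z)) (at z)"
    and w: "norm w < e"
  shows "(\<lambda>n. of_real (coeff_a \<alpha> \<beta> \<theta> \<phi> \<rho> \<kappa> z0 x0 n) * w ^ n) sums A (of_real z0 + w)"
proof -
  define a where "a w = A (of_real z0 + w)" for w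
  define b where "b w = csqrt (1 + a w * a w)" for w
  define c where "c w = of_real \<alpha> * b w - of_real \<beta> * a w + of_real \<rho> * (of_real z0 + w)" for w
  define d where "d w = exp (c w)" for w
  have shift: "of_real z0 + w \<in> ball (of_real z0) e" if "w \<in> ball 0 e" for w :: complex
    using that by (simp add: dist_norm)
  have "(A \<circ> (\<lambda>w. of_real z0 + w)) holomorphic_on ball 0 e"
    using shift by (intro holomorphic_on_compose_gen[OF _ holA] holomorphic_intros) auto
  then have hola: "a holomorphic_on ball 0 e"
    by (simp add: a_def[abs_def] o_def)
  have holb: "b holomorphic_on ball 0 e"
    unfolding b_def using one_plus_square_not_nonpos[OF Im[OF shift]]
    by (intro holomorphic_intros hola) (auto simp: a_def power2_eq_square)
  have holc: "c holomorphic_on ball 0 e"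
    unfolding c_def by (intro holomorphic_intros hola holb)
  have hold: "d holomorphic_on ball 0 e"
    unfolding d_def by (intro holomorphic_intros holc)
  have ev: "\<forall>\<^sub>F w in nhds 0. P w" if "\<And>w. w \<in> ball 0 e \<Longrightarrow> P w" for P :: "complex \<Rightarrow> bool"
  proof -
    have "\<forall>\<^sub>F w in nhds 0. w \<in> ball (0 :: complex) e"
      using e by (intro eventually_nhds_in_open) auto
    then show ?thesis by eventually_elim (rule that)
  qed
  define fa where "fa = fps_expansion a 0"
  define fb where "fb = fps_expansion b 0"
  define fd where "fd = fps_expansion d 0"
  \<comment> \<open>Defined as a combination of the other series, so that the assumption on
    \<open>fc\<close> in the recursion lemma holds by definition; that it expands \<open>c\<close>
    is checked separately.\<close>
  define fc where "fc = fps_const (of_real \<alpha>) * fb - fps_const (of_real \<beta>) * fa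
               + fps_const (of_real \<rho>) * (fps_const (of_real z0) + fps_X)"
  have fa: "a has_fps_expansion fa" and fb: "b has_fps_expansion fb" and fd: "d has_fps_expansion fd"
    unfolding fa_def fb_def fd_def using e hola holb hold by (auto intro!: has_fps_expansion_fps_expansion[OF open_ball])
  have fc: "c has_fps_expansion fc"
    unfolding c_def fc_def by (intro fps_expansion_intros fa fb)
  have deriv_a: "deriv a w = of_real (\<theta> * \<kappa> * N0 \<alpha> \<beta>) * d w" if "w \<in> ball 0 e" for w
  proof -
    have "(a has_field_derivative of_real (\<theta> * \<kappa> * N0 \<alpha> \<beta>) * d w) (at w)"
      using A'[OF shift[OF that]] DERIV_shift[of A _ w "of_real z0"]
      by (simp add: a_def[abs_def] d_def c_def b_def power2_eq_square add.commute)
    then show ?thesis by (rule DERIV_imp_deriv)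
  qed
  have deriv_d: "deriv d w = deriv c w * d w" if "w \<in> ball 0 e" for w
  proof -
    have "(c has_field_derivative deriv c w) (at w)"
      using holc that by (intro holomorphic_derivI[of _ "ball 0 e"]) auto
    then have "(d has_field_derivative deriv c w * d w) (at w)"
      unfolding d_def by (auto intro!: derivative_eq_intros)
    then show ?thesis by (rule DERIV_imp_deriv)
  qed
  \<comment> \<open>Two functions that agree on the disc have the same power series.\<close>
  have eq: "F = G" if "f has_fps_expansion F" "g has_fps_expansion G" "\<And>w. w \<in> ball 0 e \<Longrightarrow> f w = g w"
    for f g :: "complex \<Rightarrow> complex" and F G
  proof -
    have "f has_fps_expansion G \<longleftrightarrow> g has_fps_expansion G"
      by (rule has_fps_expansion_cong[OF ev refl]) (rule that(3))
    then show ?thesis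
      using that(1,2) fps_expansion_unique_complex by blast
  qed
  have "fps_nth fa n = of_real (coeff_a \<alpha> \<beta> \<theta> \<phi> \<rho> \<kappa> z0 x0 n)" for n
  proof (rule fps_nth_eq_coeff[OF \<rho> _ _ _ _ _ fc_def])
    have a0: "a 0 = of_real x0" by (simp add: a_def A0)
    have "b 0 = csqrt (of_real (1 + x0\<^sup>2))"
      by (simp add: b_def a0 power2_eq_square)
    also have "\<dots> = of_real (sqrt (1 + x0\<^sup>2))"
      by (rule of_real_sqrt[symmetric]) simp
    finally have b0: "b 0 = of_real (sqrt (1 + x0\<^sup>2))" .
    show "fps_nth fa 0 = of_real x0"
      using has_fps_expansion_imp_0_eq_fps_nth_0[OF fa] a0 by simp
    show "fps_nth fb 0 = of_real (sqrt (1 + x0\<^sup>2))"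
      using has_fps_expansion_imp_0_eq_fps_nth_0[OF fb] b0 by simp
    have "d 0 = of_real (exp (\<alpha> * sqrt (1 + x0\<^sup>2) - \<beta> * x0 + \<rho> * z0))"
      unfolding d_def c_def a0 b0 exp_of_real[symmetric] by simp
    then show "fps_nth fd 0 = of_real (exp (\<alpha> * sqrt (1 + x0\<^sup>2) - \<beta> * x0 + \<rho> * z0))"
      using has_fps_expansion_imp_0_eq_fps_nth_0[OF fd] by simp
    show "fps_deriv fa = fps_const (of_real (\<theta> * \<kappa> * N0 \<alpha> \<beta>)) * fd"
    proof (rule eq)
      show "deriv a has_fps_expansion fps_deriv fa" by (intro fps_expansion_intros fa)
      show "(\<lambda>w. of_real (\<theta> * \<kappa> * N0 \<alpha> \<beta>) * d w) has_fps_expansion fps_const (of_real (\<theta> * \<kappa> * N0 \<alpha> \<beta>)) * fd"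
        by (intro fps_expansion_intros fd)
    qed (rule deriv_a)
    show "fb * fb = 1 + fa * fa"
    proof (rule eq)
      show "(\<lambda>w. b w * b w) has_fps_expansion fb * fb" by (intro fps_expansion_intros fb)
      show "(\<lambda>w. 1 + a w * a w) has_fps_expansion 1 + fa * fa" by (intro fps_expansion_intros fa)
      show "b w * b w = 1 + a w * a w" for w
        by (simp add: b_def flip: power2_eq_square)
    qed
    show "fps_deriv fd = fps_deriv fc * fd"
    proof (rule eq)
      show "deriv d has_fps_expansion fps_deriv fd" by (intro fps_expansion_intros fd)
      show "(\<lambda>w. deriv c w * d w) has_fps_expansion fps_deriv fc * fd"
        by (intro fps_expansion_intros fc fd)
    qed (rule deriv_d)
  qed
  moreover have "(\<lambda>n. fps_nth fa n * w ^ n) sums a w"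
    \<comment> \<open>Holomorphy on the whole disc gives convergence to the function throughout it,
      not merely near its centre.\<close>
    by (rule has_fps_expansion_imp_sums_complex[OF fa, of "ereal e"]) (use hola w in auto)
  ultimately show ?thesis by (simp add: a_def)
qed

text \<open>The Taylor coefficients are real, so the complex solution is real on the real axis; its
  restriction solves the real problem and is the sum of the same series.\<close>

lemma exists_analytic_solution:
  fixes \<alpha> \<beta> \<theta> \<phi> \<rho> \<kappa> x0 z0 :: real
  assumes "\<rho> \<noteq> 0" and \<rho>: "\<rho> = \<alpha> * \<phi> + \<beta>"
  obtains A where "solves_ivp \<alpha> \<beta> \<theta> \<rho> \<kappa> z0 x0 A"
    "\<forall>\<^sub>F z in nhds z0. (\<lambda>n. coeff_a \<alpha> \<beta> \<theta> \<phi> \<rho> \<kappa> z0 x0 n * (z - z0) ^ n) sums A z"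
proof -
  let ?K = "\<theta> * \<kappa> * N0 \<alpha> \<beta>"
  obtain Ac e where Ac: "e > 0" "Ac (of_real z0) = of_real x0" "Ac holomorphic_on ball (of_real z0) e"
    "\<And>z. z \<in> ball (of_real z0) e \<Longrightarrow> \<bar>Im (Ac z)\<bar> < 1"
    "\<And>z. z \<in> ball (of_real z0) e \<Longrightarrow>
       (Ac has_field_derivative of_real ?K * exp (of_real \<alpha> * csqrt (1 + (Ac z)\<^sup>2) - of_real \<beta> * Ac z + of_real \<rho> * z)) (at z)"
    by (rule complex_ivp_solution[OF assms(1), of z0 x0 ?K \<alpha> \<beta>]) (rule that)
  define A where "A z = Re (Ac (of_real z))" for z
  have sums: "(\<lambda>n. complex_of_real (coeff_a \<alpha> \<beta> \<theta> \<phi> \<rho> \<kappa> z0 x0 n * (z - z0) ^ n)) sums Ac (of_real z)"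
    if "z \<in> ball z0 e" for z
  proof -
    have "norm (complex_of_real (z - z0)) < e"
      unfolding norm_of_real using that by (simp add: dist_real_def abs_minus_commute)
    note complex_ivp_coeffs[OF \<rho> Ac this]
    moreover have "complex_of_real z0 + of_real (z - z0) = of_real z" by simp
    ultimately show ?thesis by (simp only: of_real_mult of_real_power)
  qed
  \<comment> \<open>The imaginary parts of the terms are all zero, hence so is the imaginary part of
    the sum.\<close>
  have real: "Ac (of_real z) = of_real (A z)" if "z \<in> ball z0 e" for z
    using sums_Im[OF sums[OF that]] sums_unique2[OF sums_zero] by (simp add: A_def complex_eq_iff)
  have deriv: "(A has_real_derivative ?K * exp (\<alpha> * sqrt (1 + (A z)\<^sup>2) - \<beta> * A z + \<rho> * z)) (at z)"
    if z: "z \<in> ball z0 e" for z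
  proof -
    have "1 + (Ac (of_real z))\<^sup>2 = of_real (1 + (A z)\<^sup>2)"
      by (simp add: real[OF z])
    then have "csqrt (1 + (Ac (of_real z))\<^sup>2) = of_real (sqrt (1 + (A z)\<^sup>2))"
      by (simp only: of_real_sqrt add_nonneg_nonneg zero_le_one zero_le_power2)
    moreover have "complex_of_real z \<in> ball (of_real z0) e"
      using z by simp
    ultimately have "(Ac has_field_derivative of_real (?K * exp (\<alpha> * sqrt (1 + (A z)\<^sup>2) - \<beta> * A z + \<rho> * z))) (at (of_real z))"
      using Ac(5)[of "of_real z"]
      by (simp only: real[OF z] of_real_mult of_real_add of_real_diff flip: exp_of_real)
    then show ?thesis
      unfolding A_def[abs_def] using has_field_derivative_Re[OF has_vector_derivative_real_field] by fastforce
  qed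
  have ball: "\<forall>\<^sub>F z in nhds z0. z \<in> ball z0 e"
    using Ac(1) by (intro eventually_nhds_in_open) auto
  show ?thesis
  proof
    show "solves_ivp \<alpha> \<beta> \<theta> \<rho> \<kappa> z0 x0 A"
      unfolding solves_ivp_def using ball Ac(2) by (auto simp: A_def[of z0] elim!: eventually_mono intro: deriv)
    show "\<forall>\<^sub>F z in nhds z0. (\<lambda>n. coeff_a \<alpha> \<beta> \<theta> \<phi> \<rho> \<kappa> z0 x0 n * (z - z0) ^ n) sums A z"
      using ball by eventually_elim (use sums_Re[OF sums] in \<open>simp add: A_def\<close>)
  qed
qed

subsection \<open>Uniqueness and the quantile functions\<close>

text \<open>The density at A cancels \<open>N0\<close> and the part of the exponential that depends
  on A. What remains, \<theta> \<kappa> exp (\<rho> z), is the derivative of \<phi> \<theta> exp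
  (\<rho> z) because \<kappa> = \<phi> \<rho>.\<close>

lemma solves_ivp_first_integral:
  assumes "\<bar>\<beta>\<bar> < \<alpha>" and \<kappa>: "\<kappa> = \<phi> * \<rho>" and A: "solves_ivp \<alpha> \<beta> \<theta> \<rho> \<kappa> z0 x0 A"
  shows "\<forall>\<^sub>F z in nhds z0. F_T \<alpha> \<beta> (A z) = F_T \<alpha> \<beta> x0 + \<phi> * \<theta> * (exp (\<rho> * z) - exp (\<rho> * z0))"
proof -
  obtain e where e: "e > 0" and A': "\<And>z. z \<in> ball z0 e \<Longrightarrow> (A has_real_derivative
      \<theta> * \<kappa> * N0 \<alpha> \<beta> * exp (\<alpha> * sqrt (1 + (A z)\<^sup>2) - \<beta> * A z + \<rho> * z)) (at z)"
    using A by (auto simp: solves_ivp_def eventually_nhds_metric dist_commute)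
  let ?h = "\<lambda>z. F_T \<alpha> \<beta> (A z) - \<phi> * \<theta> * exp (\<rho> * z)"
  have "(?h has_real_derivative 0) (at z within ball z0 e)" if "z \<in> ball z0 e" for z
  proof -
    define E where "E = exp (\<alpha> * sqrt (1 + (A z)\<^sup>2) - \<beta> * A z + \<rho> * z)"
    have "f_T \<alpha> \<beta> (A z) * (N0 \<alpha> \<beta> * E) = exp (\<rho> * z)"
      using N0_pos[OF assms(1)] by (simp add: E_def f_T_eq hyp_weight_def flip: exp_add)
    moreover have "f_T \<alpha> \<beta> (A z) * (\<theta> * \<kappa> * N0 \<alpha> \<beta> * E) = \<theta> * \<kappa> * (f_T \<alpha> \<beta> (A z) * (N0 \<alpha> \<beta> * E))"
      by (simp only: mult_ac)
    ultimately have "f_T \<alpha> \<beta> (A z) * (\<theta> * \<kappa> * N0 \<alpha> \<beta> * E) = \<theta> * \<kappa> * exp (\<rho> * z)"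
      by simp
    then have "((\<lambda>z. F_T \<alpha> \<beta> (A z)) has_real_derivative \<theta> * \<kappa> * exp (\<rho> * z)) (at z)"
      using DERIV_chain2[OF F_T_has_real_derivative[OF assms(1)] A'[OF that, folded E_def]] by (simp only:)
    moreover have "((\<lambda>z. \<phi> * \<theta> * exp (\<rho> * z)) has_real_derivative \<theta> * \<kappa> * exp (\<rho> * z)) (at z)"
      by (auto intro!: derivative_eq_intros simp: \<kappa>)
    ultimately have "(?h has_real_derivative 0) (at z)"
      using DERIV_diff by fastforce
    then show ?thesis by (rule has_field_derivative_at_within)
  qed
  then obtain C where C: "\<And>z. z \<in> ball z0 e \<Longrightarrow> ?h z = C"
    using has_field_derivative_zero_constant[OF convex_ball, of z0 e ?h] by auto
  have "A z0 = x0" using A by (simp add: solves_ivp_def)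
  then have eq: "F_T \<alpha> \<beta> (A z) = F_T \<alpha> \<beta> x0 + \<phi> * \<theta> * (exp (\<rho> * z) - exp (\<rho> * z0))" if "z \<in> ball z0 e" for z
    using C[OF that] C[of z0] e by (simp add: algebra_simps)
  have "\<forall>\<^sub>F z in nhds z0. z \<in> ball z0 e"
    using e by (intro eventually_nhds_in_open) auto
  then show ?thesis by eventually_elim (rule eq)
qed

section \<open>The branches of the base quantile function as inverses of exponentials\<close>

lemma Q_B_left:
  assumes "\<bar>\<beta>\<bar> < \<alpha>" "0 < u" "u \<le> p_m \<alpha> \<beta>"
  shows "Q_B \<alpha> \<beta> u = ln (u / p_minus \<alpha> \<beta>) / (\<alpha> + \<beta>)"
    and "p_minus \<alpha> \<beta> * exp ((\<alpha> + \<beta>) * Q_B \<alpha> \<beta> u) = u"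
proof -
  show 1: "Q_B \<alpha> \<beta> u = ln (u / p_minus \<alpha> \<beta>) / (\<alpha> + \<beta>)"
    using assms by (simp add: Q_B_def)
  have "p_minus \<alpha> \<beta> > 0" using assms by (simp add: p_minus_def)
  then show "p_minus \<alpha> \<beta> * exp ((\<alpha> + \<beta>) * Q_B \<alpha> \<beta> u) = u"
    unfolding 1 using assms by simp
qed

text \<open>At \<open>p_m\<close> itself the definition selects the left branch. The weights
  \<open>p_minus\<close> and \<open>p_plus\<close> make both branches equal to \<open>x_m\<close>
  there, so the right formula also covers the endpoint.\<close>

lemma Q_B_right:
  assumes "\<bar>\<beta>\<bar> < \<alpha>" "p_m \<alpha> \<beta> \<le> u" "u < 1"
  shows "Q_B \<alpha> \<beta> u = - ln ((1 - u) / p_plus \<alpha> \<beta>) / (\<alpha> - \<beta>)"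
    and "p_plus \<alpha> \<beta> * exp (- (\<alpha> - \<beta>) * Q_B \<alpha> \<beta> u) = 1 - u"
proof -
  have pm: "0 < p_m \<alpha> \<beta>" "p_m \<alpha> \<beta> < 1"
    using range_F_T[OF assms(1)] by (auto simp: p_m_def)
  show 1: "Q_B \<alpha> \<beta> u = - ln ((1 - u) / p_plus \<alpha> \<beta>) / (\<alpha> - \<beta>)"
  proof (cases "u = p_m \<alpha> \<beta>")
    case True
    have "p_minus \<alpha> \<beta> = p_m \<alpha> \<beta> / exp ((\<alpha> + \<beta>) * x_m \<alpha> \<beta>)"
      unfolding p_minus_def mult_minus_left exp_minus by (simp add: divide_inverse)
    then have "p_m \<alpha> \<beta> / p_minus \<alpha> \<beta> = exp ((\<alpha> + \<beta>) * x_m \<alpha> \<beta>)"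
      using pm by simp
    moreover have "(1 - p_m \<alpha> \<beta>) / p_plus \<alpha> \<beta> = exp (- ((\<alpha> - \<beta>) * x_m \<alpha> \<beta>))"
      using pm by (simp add: p_plus_def exp_minus inverse_eq_divide)
    ultimately have "Q_B \<alpha> \<beta> u = x_m \<alpha> \<beta>" "- ln ((1 - u) / p_plus \<alpha> \<beta>) / (\<alpha> - \<beta>) = x_m \<alpha> \<beta>"
      using assms(1) True by (simp_all add: Q_B_def)
    then show ?thesis by simp
  next
    case False
    then show ?thesis using assms by (simp add: Q_B_def)
  qed
  have "p_plus \<alpha> \<beta> > 0" using pm by (simp add: p_plus_def)
  moreover have "- (\<alpha> - \<beta>) * Q_B \<alpha> \<beta> u = ln ((1 - u) / p_plus \<alpha> \<beta>)"
    unfolding 1 minus_divide_left[symmetric] minus_mult_minus using assms by simp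
  ultimately show "p_plus \<alpha> \<beta> * exp (- (\<alpha> - \<beta>) * Q_B \<alpha> \<beta> u) = 1 - u"
    using assms by simp
qed

text \<open>Unifies the two problems. \<open>H\<close> is the formula of one branch, continuous at
  u0 from both sides even when u0 is \<open>p_m\<close>; \<open>C\<close> is 0 on the left and 1 on
  the right.\<close>

lemma Q_B_continuous_near:
  assumes "\<bar>\<beta>\<bar> < \<alpha>"
    and "(u0 \<in> {0<..p_m \<alpha> \<beta>} \<and> S = {..p_m \<alpha> \<beta>} \<and>
            \<theta> = p_minus \<alpha> \<beta> \<and> \<phi> = 1 \<and> \<rho> = \<alpha> + \<beta>) \<or>
         (u0 \<in> {p_m \<alpha> \<beta>..<1} \<and> S = {p_m \<alpha> \<beta>..} \<and>
            \<theta> = p_plus \<alpha> \<beta> \<and> \<phi> = - 1 \<and> \<rho> = - (\<alpha> - \<beta>))"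
  obtains H and C :: real where "isCont H u0" "u0 \<in> S" "0 < u0" "u0 < 1"
    "\<And>u. u \<in> S \<Longrightarrow> 0 < u \<Longrightarrow> u < 1 \<Longrightarrow> Q_B \<alpha> \<beta> u = H u \<and> C + \<phi> * \<theta> * exp (\<rho> * Q_B \<alpha> \<beta> u) = u"
proof -
  have pm: "0 < p_m \<alpha> \<beta>" "p_m \<alpha> \<beta> < 1"
    using range_F_T[OF assms(1)] by (auto simp: p_m_def)
  from assms(2) show ?thesis
  proof
    assume *: "u0 \<in> {0<..p_m \<alpha> \<beta>} \<and> S = {..p_m \<alpha> \<beta>} \<and>
            \<theta> = p_minus \<alpha> \<beta> \<and> \<phi> = 1 \<and> \<rho> = \<alpha> + \<beta>"
    have "isCont (\<lambda>u. ln (u / p_minus \<alpha> \<beta>) / (\<alpha> + \<beta>)) u0"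
      using * pm assms(1) by (intro continuous_intros) (auto simp: p_minus_def)
    then show ?thesis
      by (rule that[of _ 0]) (use * pm Q_B_left[OF assms(1)] in auto)
  next
    assume *: "u0 \<in> {p_m \<alpha> \<beta>..<1} \<and> S = {p_m \<alpha> \<beta>..} \<and>
            \<theta> = p_plus \<alpha> \<beta> \<and> \<phi> = - 1 \<and> \<rho> = - (\<alpha> - \<beta>)"
    have "isCont (\<lambda>u. - ln ((1 - u) / p_plus \<alpha> \<beta>) / (\<alpha> - \<beta>)) u0"
      using * pm assms(1) by (intro continuous_intros) (auto simp: p_plus_def)
    then show ?thesis
    proof (rule that[of _ 1])
      fix u assume "u \<in> S" "0 < u" "u < 1"
      then show "Q_B \<alpha> \<beta> u = - ln ((1 - u) / p_plus \<alpha> \<beta>) / (\<alpha> - \<beta>) \<and> 1 + \<phi> * \<theta> * exp (\<rho> * Q_B \<alpha> \<beta> u) = u"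
        using * Q_B_right[OF assms(1), of u] by simp
    qed (use * pm in auto)
  qed
qed

text \<open>\<open>S\<close> is the closed half-line of one branch, so at u0 = \<open>p_m\<close>
  the quantile relation is one-sided while the series represents A on both sides of z0. The
  existence claim keeps the statement about all solutions from being vacuous.\<close>

theorem mainTheorem3:
  fixes \<alpha> \<beta> \<theta> \<phi> \<rho> \<kappa> u0 z0 x0 :: real and S :: "real set"
  assumes "\<alpha> > 0" and "\<bar>\<beta>\<bar> < \<alpha>"
    and "(u0 \<in> {0<..p_m \<alpha> \<beta>} \<and> S = {..p_m \<alpha> \<beta>} \<and>
            \<theta> = p_minus \<alpha> \<beta> \<and> \<phi> = 1 \<and> \<rho> = \<alpha> + \<beta> \<and> \<kappa> = \<alpha> + \<beta>) \<or>
         (u0 \<in> {p_m \<alpha> \<beta>..<1} \<and> S = {p_m \<alpha> \<beta>..} \<and>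
            \<theta> = p_plus \<alpha> \<beta> \<and> \<phi> = - 1 \<and> \<rho> = - (\<alpha> - \<beta>) \<and> \<kappa> = \<alpha> - \<beta>)"
    and "z0 = Q_B \<alpha> \<beta> u0" and "x0 = Q_T \<alpha> \<beta> u0"
  shows "(\<exists>A. solves_ivp \<alpha> \<beta> \<theta> \<rho> \<kappa> z0 x0 A) \<and>
    (\<forall>A. solves_ivp \<alpha> \<beta> \<theta> \<rho> \<kappa> z0 x0 A \<longrightarrow>
      (\<forall>\<^sub>F u in nhds u0. u \<in> S \<longrightarrow> Q_T \<alpha> \<beta> u = A (Q_B \<alpha> \<beta> u)) \<and>
      (\<forall>\<^sub>F z in nhds z0. (\<lambda>n. coeff_a \<alpha> \<beta> \<theta> \<phi> \<rho> \<kappa> z0 x0 n * (z - z0) ^ n) sums A z))"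
proof -
  have \<rho>: "\<rho> \<noteq> 0" "\<rho> = \<alpha> * \<phi> + \<beta>" and \<kappa>: "\<kappa> = \<phi> * \<rho>"
    using assms(2,3) by auto
  obtain A0 where A0: "solves_ivp \<alpha> \<beta> \<theta> \<rho> \<kappa> z0 x0 A0"
    "\<forall>\<^sub>F z in nhds z0. (\<lambda>n. coeff_a \<alpha> \<beta> \<theta> \<phi> \<rho> \<kappa> z0 x0 n * (z - z0) ^ n) sums A0 z"
    by (rule exists_analytic_solution[OF \<rho>])
  obtain H C where "isCont H u0" and u0: "u0 \<in> S" "0 < u0" "u0 < 1"
    and H: "\<And>u. u \<in> S \<Longrightarrow> 0 < u \<Longrightarrow> u < 1 \<Longrightarrow> Q_B \<alpha> \<beta> u = H u \<and> C + \<phi> * \<theta> * exp (\<rho> * Q_B \<alpha> \<beta> u) = u"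
    using Q_B_continuous_near[OF assms(2), of u0 S \<theta> \<phi> \<rho>] assms(3) by (smt (verit))
  \<comment> \<open>Evaluating the branch identity at u0 turns the integration constant of the first
    integral into \<open>C\<close>.\<close>
  have "F_T \<alpha> \<beta> x0 = u0"
    using F_T_Q_T[OF assms(2) u0(2,3)] assms(5) by simp
  then have F_T_A: "\<forall>\<^sub>F z in nhds z0. F_T \<alpha> \<beta> (A z) = C + \<phi> * \<theta> * exp (\<rho> * z)"
    if "solves_ivp \<alpha> \<beta> \<theta> \<rho> \<kappa> z0 x0 A" for A
    using solves_ivp_first_integral[OF assms(2) \<kappa> that] H[OF u0] assms(4)
    by (auto elim!: eventually_mono simp: algebra_simps)
  \<comment> \<open>Pulls statements about z near z0 back to u near u0; on \<open>S\<close> within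
    the unit interval, \<open>H\<close> is \<open>Q_B\<close>.\<close>
  have lim: "filterlim H (nhds z0) (nhds u0)"
    using \<open>isCont H u0\<close> H[OF u0] assms(4) by (simp add: isCont_def tendsto_nhds_iff)
  have unit: "\<forall>\<^sub>F u in nhds u0. u \<in> {0<..<1}"
    using u0 by (intro eventually_nhds_in_open) auto
  have "\<forall>\<^sub>F u in nhds u0. u \<in> S \<longrightarrow> Q_T \<alpha> \<beta> u = A (Q_B \<alpha> \<beta> u)"
    if A: "solves_ivp \<alpha> \<beta> \<theta> \<rho> \<kappa> z0 x0 A" for A
  proof -
    from unit eventually_compose_filterlim[OF F_T_A[OF A] lim] show ?thesis
    proof eventually_elim
      case (elim u)
      show ?case
      proof
        assume "u \<in> S"
        then have "F_T \<alpha> \<beta> (A (Q_B \<alpha> \<beta> u)) = u"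
          using elim H[of u] by auto
        then show "Q_T \<alpha> \<beta> u = A (Q_B \<alpha> \<beta> u)"
          using Q_T_F_T[OF assms(2), of "A (Q_B \<alpha> \<beta> u)"] by simp
      qed
    qed
  qed
  \<comment> \<open>An arbitrary solution and the analytic one share the first integral, and
    injectivity of \<open>F_T\<close> makes them agree near z0.\<close>
  moreover have "\<forall>\<^sub>F z in nhds z0. (\<lambda>n. coeff_a \<alpha> \<beta> \<theta> \<phi> \<rho> \<kappa> z0 x0 n * (z - z0) ^ n) sums A z"
    if "solves_ivp \<alpha> \<beta> \<theta> \<rho> \<kappa> z0 x0 A" for A
    using F_T_A[OF A0(1)] F_T_A[OF that] A0(2)
  proof eventually_elim
    case (elim z)
    have "F_T \<alpha> \<beta> (A0 z) = F_T \<alpha> \<beta> (A z)"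
      unfolding elim(1,2) ..
    then have "A0 z = A z"
      using strict_mono_eq[OF strict_mono_F_T[OF assms(2)]] by blast
    then show ?case using elim(3) by simp
  qed
  ultimately show ?thesis using A0(1) by blast
qed

end
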